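(* Let $\mathcal{T}\in\mathbb{R}^{n_1\times n_2\times n_3}$ satisfy $\mathcal{T}=(U_1^{\#},U_2^{\#},U_3^{\#}).\mathcal{G}^{\#}$ where $U_i^{\#}\in\mathbb{R}^{n_i\times r_i}_+$ with $(U_i^{\#})^\top e=e$ for $i\in\{1,2,3\}$ and $\mathcal{G}^{\#}\in\mathbb{R}^{r_1\times r_2\times r_3}$. Assume that $r_3\le r=r_1=r_2$, that $U_i^{\#}$ satisfies the SSC for $i\in\{1,2,3\}$, that the set $\mathcal{V}^{(3)}=\{\sum_{k=1}^{r_3}v_k\mathcal{G}^{\#(3)}_k : v_k\ge0\}$ contains a matrix of rank $r$, and that the set $\mathcal{V}^{(2)}=\{\sum_{k=1}^{r}v_k\mathcal{G}^{\#(2)}_k : v_k\ge0\}$ contains a matrix of rank $r_3$, where $\mathcal{G}^{\#(m)}_k$ is the $k$-th slice of $\mathcal{G}^{\#}$ along mode $m$. Let $\alpha\in\mathbb{R}^{n_3}$ and $\beta\in\mathbb{R}^{n_2}$ be random vectors drawn from continuous distributions, and consider the following procedure: 1. Let $\mathcal{T}_\alpha=\sum_{i=1}^{n_3}\alpha_i\mathcal{T}^{(3)}_i$ and $\mathcal{T}_\beta=\sum_{i=1}^{n_2}\beta_i\mathcal{T}^{(2)}_i$. 2. Let $(U_1^*,U_2^*,S_\alpha^* )$ be an optimal solution of $$\min_{U_1\in\mathbb{R}^{n_1\times r},\,U_2\in\mathbb{R}^{n_2\times r},\,S_\alpha\in\mathbb{R}^{r\times r}}|\det(S_\alpha)|\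 \text{ such that }\ \mathcal{T}_\alpha=U_1S_\alpha U_2^\top,\ U_i^\top e=e,\ U_i\ge0\text{ for }i\in\{1,2\}.$$ 3. Let $T_\beta^*=(U_1^* )^\dagger\mathcal{T}_\beta$ and let $(U_3^*,S_\beta^* )$ be an optimal solution of $$\min_{U_3\in\mathbb{R}^{n_3\times r_3},\,S_\beta\in\mathbb{R}^{r\times r_3}}\det(S_\beta^\top S_\beta)\ \text{ such that }\ T_\beta^*=S_\beta U_3^\top,\ U_3^\top e=e,\ U_3\ge0.$$ 4. Let $\mathcal{G}^*=((U_1^* )^\dagger,(U_2^* )^\dagger,(U_3^* )^\dagger).\mathcal{T}$. Then, with probability $1$, for any decomposition $(U_1^*,U_2^*,U_3^* ).\mathcal{G}^*$ obtained from this procedure, there exist permutation matrices $\Pi_1,\Pi_2,\Pi_3$ such that $U_i^*=U_i^{\#}\Pi_i$ for all $i\in\{1,2,3\}$ and $\mathcal{G}^*=(\Pi_1^\top,\Pi_2^\top,\Pi_3^\top).\mathcal{G}^{\#}$.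
   Context: $e$ is the all-ones vector of appropriate dimension, $e_k$ the $k$-th standard basis vector, $\ge$ is entrywise, and $U^\dagger$ denotes the Moore-Penrose inverse. A continuous distribution on $\mathbb{R}^n$ means one that is absolutely continuous with respect to Lebesgue measure. For matrices $U_i\in\mathbb{R}^{n_i\times r_i}$ and $\mathcal{G}\in\mathbb{R}^{r_1\times r_2\times r_3}$, the tensor $(U_1,U_2,U_3).\mathcal{G}\in\mathbb{R}^{n_1\times n_2\times n_3}$ has entries $\sum_{i_1,i_2,i_3}(U_1)_{j_1,i_1}(U_2)_{j_2,i_2}(U_3)_{j_3,i_3}\mathcal{G}_{i_1,i_2,i_3}$. Slices of $\mathcal{T}\in\mathbb{R}^{n_1\times n_2\times n_3}$: along the third mode, $\mathcal{T}^{(3)}_k\in\mathbb{R}^{n_1\times n_2}$ with $(\mathcal{T}^{(3)}_k)_{i,j}=\mathcal{T}_{i,j,k}$; along the second mode, $\mathcal{T}^{(2)}_j\in\mathbb{R}^{n_1\times n_3}$ with $(\mathcal{T}^{(2)}_j)_{i,k}=\mathcal{T}_{i,j,k}$. For $A\in\mathbb{R}^{m\times n}$, $\operatorname{cone}(A)=\{Ay : y\in\mathbb{R}^n, y\ge 0\}$ and $\operatorname{cone}^*(A)=\{y\in\mathbb{R}^m : A^\top y\ge 0\}$. A matrix $H\in\mathbb{R}^{n\times r}_+$ with $r\ge2$ satisfies the sufficiently scattered condition (SSC) if: (SSC1) $\{x\in\mathbb{R}^r_+ : e^\top x\ge\sqrt{r-1}\,\|x\|_2\}\subseteq\operatorname{cone}(H^\top)$;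 and (SSC2) $\operatorname{cone}^*(H^\top)\cap\operatorname{bd}(\mathcal{C}^* )=\{\lambda e_k : \lambda\ge0,\ k\in\{1,\dots,r\}\}$, where $\mathcal{C}^*=\{x\in\mathbb{R}^r : e^\top x\ge\|x\|_2\}$ and $\operatorname{bd}$ denotes the boundary. *)

theory Defs
  imports "HOL-Analysis.Analysis" "HOL-Probability.Probability"
begin

text \<open>
  A tensor with modes indexed by \<open>'a\<close>, \<open>'b\<close>, \<open>'c\<close> has entries \<open>T $ i $ j $ k\<close>.
  On vectors, \<open>1\<close> is the all-ones vector (the identity matrix is \<open>mat 1\<close>), and \<open>\<le>\<close> is
  entrywise on vectors as well as on matrices.
\<close>

type_synonym ('a, 'b, 'c) tensor = "real^'c^'b^'a"

definition tucker ::
  "real^'r1^'n1 \<Rightarrow> real^'r2^'n2 \<Rightarrow> real^'r3^'n3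
    \<Rightarrow> ('r1, 'r2, 'r3) tensor \<Rightarrow> ('n1, 'n2, 'n3) tensor" where
  "tucker U1 U2 U3 G =
    (\<chi> j1 j2 j3. \<Sum>i1\<in>UNIV. \<Sum>i2\<in>UNIV. \<Sum>i3\<in>UNIV.
      U1 $ j1 $ i1 * U2 $ j2 $ i2 * U3 $ j3 $ i3 * G $ i1 $ i2 $ i3)"

definition slice2 :: "('n1::finite, 'n2::finite, 'n3::finite) tensor \<Rightarrow> 'n2 \<Rightarrow> real^'n3^'n1" where
  "slice2 T j = (\<chi> i k. T $ i $ j $ k)"

definition slice3 :: "('n1::finite, 'n2::finite, 'n3::finite) tensor \<Rightarrow> 'n3 \<Rightarrow> real^'n2^'n1" where
  "slice3 T k = (\<chi> i j. T $ i $ j $ k)"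

definition cone_gen :: "real^'n^'m \<Rightarrow> (real^'m) set" where
  "cone_gen A = {A *v y | y. 0 \<le> y}"

definition cone_dual :: "real^'n^'m \<Rightarrow> (real^'m) set" where
  "cone_dual A = {y. 0 \<le> transpose A *v y}"

definition SSC1 :: "real^'r^'n \<Rightarrow> bool" where
  "SSC1 H \<longleftrightarrow>
    {x. 0 \<le> x \<and> 1 \<bullet> x \<ge> sqrt (real CARD('r) - 1) * norm x} \<subseteq> cone_gen (transpose H)"

definition SSC2 :: "real^'r^'n \<Rightarrow> bool" where
  "SSC2 H \<longleftrightarrow>
    cone_dual (transpose H) \<inter> frontier {x. 1 \<bullet> x \<ge> norm x} =
      {c *\<^sub>R axis k 1 | c k. 0 \<le> c}"

definition sufficiently_scattered :: "real^'r^'n \<Rightarrow> bool" where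
  "sufficiently_scattered H \<longleftrightarrow> 0 \<le> H \<and> CARD('r) \<ge> 2 \<and> SSC1 H \<and> SSC2 H"

text \<open>The Moore--Penrose inverse: the unique matrix satisfying the four Penrose equations.\<close>

definition pinv :: "real^'n^'m \<Rightarrow> real^'m^'n" where
  "pinv A = (THE X. A ** X ** A = A \<and> X ** A ** X = X \<and>
    transpose (A ** X) = A ** X \<and> transpose (X ** A) = X ** A)"

definition permutation_matrix :: "real^'n^'n \<Rightarrow> bool" where
  "permutation_matrix P \<longleftrightarrow>
    (\<exists>p. p permutes UNIV \<and> P = (\<chi> i j. if i = p j then 1 else 0))"

definition continuous_random_vector :: "'w measure \<Rightarrow> ('w \<Rightarrow> real^'n) \<Rightarrow> bool" where
  "continuous_random_vector M X \<longleftrightarrow>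
    X \<in> borel_measurable M \<and> absolutely_continuous lborel (distr M borel X)"

definition step2_optimal ::
  "real^'n2^'n1 \<Rightarrow> real^'r^'n1 \<Rightarrow> real^'r^'n2 \<Rightarrow> real^'r^'r \<Rightarrow> bool" where
  "step2_optimal Ta U1 U2 S \<longleftrightarrow>
    is_arg_min
      (\<lambda>(V1 :: real^'r^'n1, V2 :: real^'r^'n2, R :: real^'r^'r). \<bar>det R\<bar>)
      (\<lambda>(V1, V2, R). Ta = V1 ** R ** transpose V2 \<and>
        transpose V1 *v 1 = 1 \<and> transpose V2 *v 1 = 1 \<and> 0 \<le> V1 \<and> 0 \<le> V2)
      (U1, U2, S)"

definition step3_optimal ::
  "real^'n3^'r \<Rightarrow> real^'r3^'n3 \<Rightarrow> real^'r3^'r \<Rightarrow> bool" where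
  "step3_optimal Tb U3 S \<longleftrightarrow>
    is_arg_min
      (\<lambda>(V3 :: real^'r3^'n3, R :: real^'r3^'r). det (transpose R ** R))
      (\<lambda>(V3, R). Tb = R ** transpose V3 \<and> transpose V3 *v 1 = 1 \<and> 0 \<le> V3)
      (U3, S)"

definition procedure_output ::
  "('n1, 'n2, 'n3) tensor \<Rightarrow> real^'n3 \<Rightarrow> real^'n2
    \<Rightarrow> real^'r^'n1 \<Rightarrow> real^'r^'n2 \<Rightarrow> real^'r3^'n3 \<Rightarrow> ('r, 'r, 'r3) tensor \<Rightarrow> bool" where
  "procedure_output T a b U1 U2 U3 G \<longleftrightarrow>
    (\<exists>Sa Sb.
      step2_optimal (\<Sum>k\<in>UNIV. a $ k *\<^sub>R slice3 T k) U1 U2 Sa \<and>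
      step3_optimal (pinv U1 ** (\<Sum>j\<in>UNIV. b $ j *\<^sub>R slice2 T j)) U3 Sb \<and>
      G = tucker (pinv U1) (pinv U2) (pinv U3) T)"

end

theory Submission
  imports Defs
begin

text \<open>
  With probability one the core matrices \<open>S\<^sub>\<alpha>\<close> and \<open>S\<^sub>\<beta>\<close> have full column rank: their Gram
  determinants are polynomials in \<open>\<alpha>\<close> and \<open>\<beta>\<close> that do not vanish identically, and restricted to
  lines in a direction with full rank they have finitely many zeros.
  By rank considerations any feasible factor is then \<open>U\<^sub>i Q\<^sub>i\<close> with \<open>Q\<^sub>i\<close> square, and optimality gives
  \<open>\<bar>det Q\<^sub>1\<bar> \<bar>det Q\<^sub>2\<bar> \<ge> 1\<close> in step 2 and \<open>\<bar>det Q\<^sub>3\<bar> \<ge> 1\<close> in step 3. Dually to SSC1, each column \<open>q\<close>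
  of \<open>Q\<^sub>i\<close> satisfies \<open>\<parallel>q\<parallel> \<le> e\<^sup>T q = 1\<close>, so Hadamard's inequality gives \<open>\<bar>det Q\<^sub>i\<bar> \<le> 1\<close>; in the equality
  case the columns have norm one, and SSC2 forces them to be standard basis vectors.
\<close>

section \<open>Null sets and almost sure full column rank\<close>

text \<open>Compute the integral of the indicator of \<open>x + t d \<in> S\<close> over \<open>t \<in> [0, 1]\<close> in both orders: by
  translation invariance one gives the measure of \<open>S\<close>, the other gives zero.\<close>

lemma null_set_if_lines_null:
  fixes S :: "'a::euclidean_space set"
  assumes S [measurable]: "S \<in> sets borel"
    and lines: "\<And>x. {t::real. x + t *\<^sub>R d \<in> S} \<in> null_sets lborel"
  shows "S \<in> null_sets lborel"
proof -
  define f :: "real \<Rightarrow> 'a \<Rightarrow> ennreal"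
    where "f t x = indicator {0..1} t * indicator S (x + t *\<^sub>R d)" for t x
  have [measurable]: "case_prod f \<in> borel_measurable (lborel \<Otimes>\<^sub>M lborel)"
    unfolding f_def by measurable
  have "(\<integral>\<^sup>+x. f t x \<partial>lborel) = indicator {0..1} t * emeasure lborel S" for t
  proof -
    have "emeasure lborel S = emeasure (distr lborel borel ((+) (t *\<^sub>R d))) S"
      by (simp add: lborel_distr_plus)
    also have "\<dots> = (\<integral>\<^sup>+x. indicator S (t *\<^sub>R d + x) \<partial>lborel)"
      by (subst nn_integral_indicator[symmetric], simp, subst nn_integral_distr) auto
    finally show ?thesis
      unfolding f_def by (subst nn_integral_cmult) (auto simp: add.commute)
  qed
  then have "emeasure lborel S = (\<integral>\<^sup>+t. (\<integral>\<^sup>+x. f t x \<partial>lborel) \<partial>lborel)"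
    by (simp add: nn_integral_multc)
  also have "\<dots> = (\<integral>\<^sup>+x. (\<integral>\<^sup>+t. f t x \<partial>lborel) \<partial>lborel)"
    by (rule lborel_pair.Fubini'[symmetric]) simp
  also have "\<dots> = (\<integral>\<^sup>+x. 0 \<partial>(lborel::'a measure))"
  proof (rule nn_integral_cong)
    fix x :: 'a
    have "AE t in lborel. f t x = 0"
      by (rule AE_I'[OF lines[of x]]) (auto simp: f_def indicator_def)
    then show "(\<integral>\<^sup>+t. f t x \<partial>lborel) = 0"
      by (subst nn_integral_0_iff_AE) (auto simp: f_def)
  qed
  finally show ?thesis by (auto simp: null_sets_def)
qed

lemma gram_affine_poly:
  fixes A B :: "real^'n^'m"
  obtains p where "\<And>t. poly p t = det (transpose (A + t *\<^sub>R B) ** (A + t *\<^sub>R B))"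
proof
  fix t
  \<comment> \<open>This is the Leibniz expansion of the Gram determinant with the affine entries
    read as linear polynomials in \<open>t\<close>.\<close>
  show "poly (\<Sum>q | q permutes (UNIV::'n set). of_int (sign q) * (\<Prod>i\<in>UNIV.
        \<Sum>k\<in>UNIV. [:A$k$i, B$k$i:] * [:A$k$q i, B$k$q i:])) t
      = det (transpose (A + t *\<^sub>R B) ** (A + t *\<^sub>R B))"
    by (simp add: det_def poly_sum poly_prod poly_of_int matrix_matrix_mult_def transpose_def
        algebra_simps)
qed

text \<open>Substituting \<open>s = 1 / t\<close> turns this into a polynomial that is nonzero at \<open>s = 0\<close>.\<close>

lemma finite_zeros_gram_affine:
  fixes A B :: "real^'n^'m"
  assumes "det (transpose B ** B) \<noteq> 0"
  shows "finite {t. det (transpose (A + t *\<^sub>R B) ** (A + t *\<^sub>R B)) = 0}"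
proof -
  obtain p where p: "\<And>s. poly p s = det (transpose (B + s *\<^sub>R A) ** (B + s *\<^sub>R A))"
    using gram_affine_poly[of B A] by metis
  have "poly p 0 \<noteq> 0" using assms by (simp add: p)
  then have "p \<noteq> 0" by auto
  then have fin: "finite {s. poly p s = 0}" by (rule poly_roots_finite)
  \<comment> \<open>The substitution cannot see \<open>t = 0\<close>, so that point is added by
    hand.\<close>
  have "{t. det (transpose (A + t *\<^sub>R B) ** (A + t *\<^sub>R B)) = 0} \<subseteq> insert 0 (inverse ` {s. poly p s = 0})"
  proof
    fix t assume t: "t \<in> {t. det (transpose (A + t *\<^sub>R B) ** (A + t *\<^sub>R B)) = 0}"
    show "t \<in> insert 0 (inverse ` {s. poly p s = 0})"
    proof (cases "t = 0")
      case False
      let ?M = "A + t *\<^sub>R B"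
      have "B + inverse t *\<^sub>R A = inverse t *\<^sub>R ?M"
        using False by (simp add: scaleR_add_right)
      \<comment> \<open>Scaling is expressed as a product with a scalar matrix, so that
        \<open>det_mul\<close> transfers the vanishing determinant.\<close>
      then have "transpose (B + inverse t *\<^sub>R A) ** (B + inverse t *\<^sub>R A)
          = (transpose ?M ** ?M) ** (mat ((inverse t)\<^sup>2))"
        by (simp add: vec_eq_iff matrix_matrix_mult_def transpose_def mat_def if_distrib 
            sum.delta sum_distrib_left sum_distrib_right power2_eq_square mult_ac cong: if_cong)
      then have "poly p (inverse t) = 0"
        using t by (simp add: p det_mul)
      then have "inverse (inverse t) \<in> inverse ` {s. poly p s = 0}" by blast
      then show ?thesis by simp
    qed simp
  qed
  then show ?thesis using fin by (meson finite_imageI finite_insert finite_subset)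
qed

text \<open>Since \<open>z \<bullet> (transpose A *v (A *v z))\<close> is the squared norm of
  \<open>A *v z\<close>, a matrix and its Gram matrix have the same kernel. Full column rank becomes
  a polynomial condition on the entries.\<close>

lemma left_invertible_iff_gram:
  fixes A :: "real^'n^'m"
  shows "(\<exists>L. L ** A = mat 1) \<longleftrightarrow> det (transpose A ** A) \<noteq> 0"
proof
  assume "\<exists>L. L ** A = mat 1"
  then have inj: "inj ((*v) A)" by (simp add: matrix_left_invertible_injective)
  have "inj ((*v) (transpose A ** A))"
  proof (rule injI)
    fix x y assume eq: "(transpose A ** A) *v x = (transpose A ** A) *v y"
    define z where "z = x - y"
    have "(transpose A ** A) *v z = 0"
      using eq by (simp add: z_def matrix_vector_mult_diff_distrib)
    then have "z \<bullet> (transpose A *v (A *v z)) = 0"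
      by (simp add: matrix_vector_mul_assoc del: transpose_matrix_vector)
    then have "(A *v z) \<bullet> (A *v z) = 0"
      by (metis dot_lmul_matrix vector_transpose_matrix transpose_transpose)
    then have "A *v z = 0" by simp
    then have "A *v x = A *v y" by (simp add: z_def matrix_vector_mult_diff_distrib)
    then show "x = y" using inj by (auto dest: injD)
  qed
  then show "det (transpose A ** A) \<noteq> 0"
    by (simp flip: matrix_left_invertible_injective invertible_left_inverse invertible_det_nz)
next
  assume "det (transpose A ** A) \<noteq> 0"
  then obtain B where "B ** (transpose A ** A) = mat 1"
    by (auto simp flip: invertible_det_nz simp: invertible_left_inverse)
  then show "\<exists>L. L ** A = mat 1" by (auto simp: matrix_mul_assoc)
qed

lemma borel_measurable_det_gram:
  fixes N :: "'a::euclidean_space \<Rightarrow> real^'n^'m"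
  assumes "linear N"
  shows "(\<lambda>a. det (transpose (N a) ** N a)) \<in> borel_measurable borel"
proof (rule borel_measurable_continuous_onI)
  have "continuous_on UNIV N"
    using linear_continuous_on[of N UNIV] assms by (simp add: linear_conv_bounded_linear)
  then show "continuous_on UNIV (\<lambda>a. det (transpose (N a) ** N a))"
    unfolding det_def matrix_matrix_mult_def transpose_def
    by (auto intro!: continuous_intros)
qed

text \<open>One parameter \<open>d\<close> of full rank suffices: each line in direction
  \<open>d\<close> meets the exceptional set in finitely many points.\<close>

lemma AE_left_invertible:
  fixes N :: "'a::euclidean_space \<Rightarrow> real^'n^'m"
  assumes N: "linear N" and L: "L ** N d = mat 1"
  shows "AE a in lborel. \<exists>L. L ** N a = mat 1"
proof -
  let ?g = "\<lambda>a. det (transpose (N a) ** N a)"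
  note [measurable] = borel_measurable_det_gram[OF N]
  have "{a. ?g a = 0} \<in> null_sets lborel"
  proof (rule null_set_if_lines_null[where d = d])
    fix x
    have "det (transpose (N d) ** N d) \<noteq> 0"
      using L left_invertible_iff_gram by blast
    from finite_zeros_gram_affine[OF this, of "N x"]
    have "finite {t. x + t *\<^sub>R d \<in> {a. ?g a = 0}}"
      by (simp add: linear_add[OF N] linear_scale[OF N])
    then show "{t. x + t *\<^sub>R d \<in> {a. ?g a = 0}} \<in> null_sets lborel"
      by (rule finite_imp_null_set_lborel)
  qed simp
  then show ?thesis
    by (rule AE_I') (auto simp: left_invertible_iff_gram)
qed

lemma AE_continuous_random_vector:
  assumes "continuous_random_vector M X" and "AE x in lborel. P x"
  shows "AE \<omega> in M. P (X \<omega>)"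
proof -
  have X: "X \<in> measurable M borel" and ac: "absolutely_continuous lborel (distr M borel X)"
    using assms(1) by (auto simp: continuous_random_vector_def)
  have "AE x in distr M borel X. P x"
    by (rule absolutely_continuous_AE[OF _ ac assms(2)]) simp
  then show ?thesis by (rule AE_distrD[OF X])
qed

section \<open>Hadamard's inequality\<close>

text \<open>Gram-Schmidt without normalization, by induction on the set of rows already made
  orthogonal. Subtracting the projection onto their span preserves the determinant and cannot
  lengthen the new row.\<close>

lemma det_Gram_Schmidt:
  fixes A :: "real^'n^'n"
  assumes "finite S"
  shows "\<exists>B. det B = det A \<and> (\<forall>i. norm (row i B) \<le> norm (row i A)) \<and>
    (\<forall>i\<in>S. \<forall>j\<in>S. i \<noteq> j \<longrightarrow> orthogonal (row i B) (row j B))"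
  using assms
proof (induction S)
  case empty
  show ?case by (intro exI[of _ A]) simp
next
  case (insert i S)
  then obtain B where B: "det B = det A" "\<And>k. norm (row k B) \<le> norm (row k A)"
    "\<And>k l. k \<in> S \<Longrightarrow> l \<in> S \<Longrightarrow> k \<noteq> l \<Longrightarrow> orthogonal (row k B) (row l B)"
    by blast
  let ?R = "{row j B |j. j \<in> S}"
  have "\<exists>y z. y \<in> span ?R \<and> (\<forall>w \<in> span ?R. orthogonal z w) \<and> row i B = y + z"
    by (rule orthogonal_subspace_decomp_exists[of ?R "row i B"]) blast
  then obtain y z where y: "y \<in> span ?R"
    and z: "\<And>w. w \<in> span ?R \<Longrightarrow> orthogonal z w" and yz: "row i B = y + z"
    by blast
  define C :: "real^'n^'n" where "C = (\<chi> k. if k = i then row i B + (- y) else row k B)"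
  have "{row j B |j. j \<in> S} \<subseteq> {row j B |j. j \<noteq> i}"
    using insert.hyps by auto
  from subsetD[OF span_mono[OF this] y] have "- y \<in> span {row j B |j. j \<noteq> i}"
    by (rule span_neg)
  then have "det C = det B"
    unfolding C_def by (intro det_row_span) (simp add: span_vec_eq)
  have rowi: "row i C = z" and rowk: "\<And>k. k \<noteq> i \<Longrightarrow> row k C = row k B"
    using yz by (auto simp: C_def row_def vec_eq_iff)
  have "(norm (row i B))\<^sup>2 = (norm y)\<^sup>2 + (norm z)\<^sup>2"
    unfolding yz using z[OF y] by (intro norm_add_Pythagorean) (simp only: orthogonal_commute)
  then have "(norm z)\<^sup>2 \<le> (norm (row i B))\<^sup>2"
    by simp
  then have "norm z \<le> norm (row i B)"
    by (rule power2_le_imp_le) simp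
  then have "norm (row k C) \<le> norm (row k A)" for k
    using B(2) rowi rowk by (metis order_trans)
  moreover have "orthogonal (row k C) (row l C)" if "k \<in> insert i S" "l \<in> insert i S" "k \<noteq> l" for k l
  proof -
    have "orthogonal z (row j B)" if "j \<in> S" for j
      using that by (intro z span_base) blast
    then show ?thesis
      using that B(3) insert.hyps rowi rowk by (metis insert_iff orthogonal_commute)
  qed
  ultimately show ?case
    using \<open>det C = det B\<close> B(1) by (intro exI[of _ C]) auto
qed

text \<open>Once the rows are orthogonal, \<open>B ** transpose B\<close> is diagonal with the
  squared row norms on its diagonal.\<close>

lemma Hadamard_inequality:
  fixes A :: "real^'n^'n"
  shows "\<bar>det A\<bar> \<le> (\<Prod>i\<in>UNIV. norm (row i A))"
proof -
  obtain B where B: "det B = det A" "\<And>i. norm (row i B) \<le> norm (row i A)"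
    "\<And>i j. i \<noteq> j \<Longrightarrow> orthogonal (row i B) (row j B)"
    using det_Gram_Schmidt[of UNIV A] by auto
  have ij: "(B ** transpose B) $ i $ j = row i B \<bullet> row j B" for i j
    by (simp add: matrix_matrix_mult_def transpose_def row_def inner_vec_def)
  have "(det B)\<^sup>2 = det (B ** transpose B)"
    by (simp add: det_mul power2_eq_square)
  also have "\<dots> = (\<Prod>i\<in>UNIV. row i B \<bullet> row i B)"
    using B(3) by (subst det_diagonal) (auto simp: ij orthogonal_def)
  also have "\<dots> = (\<Prod>i\<in>UNIV. norm (row i B))\<^sup>2"
    by (simp add: dot_square_norm prod_power_distrib)
  finally have "\<bar>det B\<bar> = \<bar>\<Prod>i\<in>UNIV. norm (row i B)\<bar>"
    by (simp only: power2_eq_iff abs_eq_iff)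
  also have "\<dots> = (\<Prod>i\<in>UNIV. norm (row i B))"
    by (simp add: prod_nonneg)
  also have "\<dots> \<le> (\<Prod>i\<in>UNIV. norm (row i A))"
    by (intro prod_mono) (simp add: B(2))
  finally show ?thesis by (simp add: B(1))
qed

section \<open>Moore-Penrose inverses of matrices with full column rank\<close>

text \<open>\<open>pinv\<close> is a definite description, so existence and uniqueness both have to
  be shown. The witness is \<open>B ** transpose A\<close>, where \<open>B\<close> inverts the Gram
  matrix.\<close>

lemma pinv_left_inverse:
  fixes A :: "real^'n^'m"
  assumes L: "L ** A = mat 1"
  shows "pinv A ** A = mat 1"
proof -
  let ?P = "\<lambda>X. A ** X ** A = A \<and> X ** A ** X = X \<and>
    transpose (A ** X) = A ** X \<and> transpose (X ** A) = X ** A"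
  have left: "X ** A = mat 1" if "A ** X ** A = A" for X
    by (metis L matrix_mul_assoc matrix_mul_lid that)
  have uniq: "X = Y" if X: "?P X" and Y: "?P Y" for X Y
  proof -
    \<comment> \<open>Both \<open>A ** X\<close> and \<open>A ** Y\<close> are the orthogonal
      projection onto the column space of \<open>A\<close>, hence equal.\<close>
    have "A ** X = transpose X ** transpose A"
      using X by (metis matrix_transpose_mul)
    also have "\<dots> = transpose X ** transpose A ** transpose Y ** transpose A"
      using Y by (metis matrix_mul_assoc matrix_transpose_mul)
    also have "\<dots> = A ** X ** (A ** Y)"
      using X Y by (metis matrix_mul_assoc matrix_transpose_mul)
    also have "\<dots> = A ** Y"
      using X by (simp add: matrix_mul_assoc)
    finally have "X ** (A ** X) = X ** (A ** Y)" by simp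
    then show ?thesis
      using left[of X] left[of Y] X Y by (simp add: matrix_mul_assoc)
  qed
  have "det (transpose A ** A) \<noteq> 0"
    using L left_invertible_iff_gram by blast
  then obtain B where B: "B ** (transpose A ** A) = mat 1"
    by (auto simp flip: invertible_det_nz simp: invertible_left_inverse)
  have AAB: "transpose A ** A ** B = mat 1"
    using B matrix_left_right_inverse by blast
  have "transpose B = transpose B ** (transpose A ** A ** B)"
    by (simp add: AAB)
  also have "\<dots> = transpose (transpose A ** A ** B) ** B"
    by (simp add: matrix_transpose_mul matrix_mul_assoc)
  also have "\<dots> = B"
    by (simp add: AAB)
  finally have Bt: "transpose B = B" .
  have BA: "B ** transpose A ** A = mat 1"
    using B by (simp add: matrix_mul_assoc)
  have PB: "?P (B ** transpose A)"
    using BA by (simp add: matrix_transpose_mul Bt flip: matrix_mul_assoc)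
  have "?P (pinv A)"
    unfolding pinv_def by (rule theI[of ?P, OF PB uniq[OF _ PB]])
  then show ?thesis using left by blast
qed

section \<open>Geometry of the sufficiently scattered condition\<close>

lemma norm_one_vec: "norm (1 :: real^'n) = sqrt (real CARD('n))"
  by (simp add: norm_vec_def L2_set_def)

text \<open>SSC1 writes \<open>x\<close> as a nonnegative combination of the rows of
  \<open>H\<close>, so the pairing with \<open>y\<close> becomes one of \<open>H *v y\<close> with
  nonnegative weights.\<close>

lemma SSC1_inner_nonneg:
  fixes H :: "real^'r^'n"
  assumes "SSC1 H" and x: "1 \<bullet> x \<ge> sqrt (real CARD('r) - 1) * norm x" and x0: "0 \<le> x"
    and Hy: "0 \<le> H *v y"
  shows "0 \<le> x \<bullet> y"
proof -
  have "x \<in> cone_gen (transpose H)"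
    using assms unfolding SSC1_def by blast
  then obtain z where z: "x = transpose H *v z" "0 \<le> z"
    unfolding cone_gen_def by blast
  have "x \<bullet> y = z \<bullet> (H *v y)"
    by (simp add: z dot_lmul_matrix)
  also have "\<dots> \<ge> 0"
    using z(2) Hy by (auto simp: inner_vec_def less_eq_vec_def intro!: sum_nonneg mult_nonneg_nonneg)
  finally show ?thesis by simp
qed

text \<open>It suffices to test \<open>y\<close> against a single \<open>x\<close> in the cone of
  SSC1, tilted away from the component \<open>w\<close> of \<open>y\<close> orthogonal to the
  all-ones vector. The resulting bound on \<open>norm w\<close> gives the claim by
  Pythagoras.\<close>

lemma SSC1_dual_cone:
  fixes H :: "real^'r^'n"
  assumes H: "SSC1 H" and r: "CARD('r) \<ge> 2" and Hy: "0 \<le> H *v y"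
  shows "norm y \<le> 1 \<bullet> y"
proof -
  define r :: real where "r = real CARD('r)"
  have r2: "r \<ge> 2" using r by (simp add: r_def)
  have n1: "norm (1 :: real^'r) = sqrt r" by (simp add: norm_one_vec r_def)
  then have ee: "(1 :: real^'r) \<bullet> 1 = r" using r2 by (simp add: dot_square_norm)
  define s where "s = 1 \<bullet> y"
  define w where "w = y - (s / r) *\<^sub>R 1"
  have w1: "1 \<bullet> w = 0" using r2 by (simp add: w_def inner_diff_right ee s_def)
  have yw: "y = (s / r) *\<^sub>R 1 + w" by (simp add: w_def)
  \<comment> \<open>As \<open>sgn 0 = 0\<close>, the case \<open>w = 0\<close> is included, and only
    \<open>norm u \<le> 1\<close> holds in general.\<close>
  define u where "u = sgn w"
  have u1: "1 \<bullet> u = 0" using w1 by (simp add: u_def sgn_div_norm)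
  have nu: "norm u \<le> 1" by (simp add: u_def norm_sgn)
  have wu: "u \<bullet> w = norm w" 
    by (cases "w = 0") (simp_all add: u_def sgn_div_norm dot_square_norm power2_eq_square)
  \<comment> \<open>\<open>c\<close> is chosen so that \<open>x\<close> lies on the boundary of the cone in SSC1.\<close>
  define c where "c = sqrt (r / (r - 1))"
  have c2: "c\<^sup>2 = r / (r - 1)" and c0: "c > 0" using r2 by (simp_all add: c_def)
  define x where "x = 1 - c *\<^sub>R u"
  have "0 \<le> x"
  proof -
    have "c * u $ i \<le> 1" for i
    proof -
      \<comment> \<open>Projecting the axis vector orthogonally to the all-ones vector keeps its
        product with \<open>u\<close> and shortens it to norm \<open>1 / c\<close>; Cauchy-Schwarz
        with the axis vector itself would be too weak.\<close>
      have "u $ i = u \<bullet> (axis i 1 - (1/r) *\<^sub>R 1)"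
        using u1 by (simp add: inner_diff_right inner_axis inner_commute)
      also have "\<dots> \<le> norm u * norm (axis i 1 - (1/r) *\<^sub>R 1 :: real^'r)"
        by (rule norm_cauchy_schwarz)
      also have "\<dots> \<le> 1 * norm (axis i 1 - (1/r) *\<^sub>R 1 :: real^'r)"
        using nu by (intro mult_right_mono) auto
      also have "norm (axis i 1 - (1/r) *\<^sub>R 1 :: real^'r) = sqrt ((r - 1) / r)"
      proof -
        have ai: "axis i 1 \<bullet> (1 :: real^'r) = 1" "(1 :: real^'r) \<bullet> axis i 1 = 1"
          by (simp_all add: inner_axis inner_axis')
        have "(axis i 1 - (1/r) *\<^sub>R 1) \<bullet> (axis i 1 - (1/r) *\<^sub>R 1 :: real^'r) = 1 - 2 / r + 1 / r"
          using r2 by (simp add: inner_diff_left inner_diff_right ai ee inner_axis_axis field_simps)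
        also have "\<dots> = (r - 1) / r" using r2 by (simp add: field_simps)
        finally show ?thesis by (simp add: norm_eq_sqrt_inner)
      qed
      finally have "c * u $ i \<le> c * sqrt ((r - 1) / r)" using c0 by simp
      also have "\<dots> = 1" using r2 by (simp add: c_def flip: real_sqrt_mult)
      finally show ?thesis .
    qed
    then show ?thesis by (simp add: less_eq_vec_def x_def)
  qed
  moreover have "1 \<bullet> x = r" using u1 by (simp add: x_def inner_diff_right ee)
  moreover have "sqrt (r - 1) * norm x \<le> r"
  proof -
    have "x \<bullet> x = r + c\<^sup>2 * (norm u)\<^sup>2"
      using u1 by (simp add: x_def inner_diff_left inner_diff_right ee inner_commute
          power2_norm_eq_inner) (simp add: power2_eq_square)
    also have "\<dots> \<le> r + c\<^sup>2 * 1"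
      using nu by (intro add_left_mono mult_left_mono) (auto simp: power_le_one)
    also have "\<dots> = r\<^sup>2 / (r - 1)"
      unfolding c2 using r2 by (simp add: field_simps power2_eq_square)
    finally have "norm x \<le> sqrt (r\<^sup>2 / (r - 1))" by (simp add: norm_eq_sqrt_inner)
    then have "sqrt (r - 1) * norm x \<le> sqrt (r - 1) * sqrt (r\<^sup>2 / (r - 1))"
      using r2 by (intro mult_left_mono) auto
    also have "\<dots> = r" using r2 by (simp flip: real_sqrt_mult)
    finally show ?thesis .
  qed
  ultimately have "0 \<le> x \<bullet> y"
    by (intro SSC1_inner_nonneg[OF H _ _ Hy]) (auto simp: r_def)
  also have "x \<bullet> y = s - c * norm w"
  proof -
    have "u \<bullet> y = norm w"
      using u1 wu by (subst yw) (simp add: inner_add_right inner_commute)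
    then show ?thesis by (simp add: x_def inner_diff_left s_def)
  qed
  finally have sc: "c * norm w \<le> s" by simp
  then have s0: "0 \<le> s" using c0 by (meson less_imp_le norm_ge_zero order_trans mult_nonneg_nonneg)
  have "(c * norm w)\<^sup>2 \<le> s\<^sup>2" using sc c0 by (intro power_mono) auto
  then have "r / (r - 1) * (norm w)\<^sup>2 \<le> s\<^sup>2" by (simp add: power_mult_distrib c2)
  then have "r * (norm w)\<^sup>2 \<le> (r - 1) * s\<^sup>2" using r2 by (simp add: field_simps)
  moreover have "(norm y)\<^sup>2 = s\<^sup>2 / r + (norm w)\<^sup>2"
  proof -
    have "y \<bullet> y = (s / r)\<^sup>2 * r + w \<bullet> w"
      using w1 by (subst (1 2) yw) (simp add: inner_add_left inner_add_right ee inner_commute power2_eq_square)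
    then show ?thesis using r2 by (simp add: dot_square_norm power2_eq_square)
  qed
  ultimately have "r * (norm y)\<^sup>2 \<le> r * s\<^sup>2" using r2 by (simp add: field_simps)
  then have "(norm y)\<^sup>2 \<le> s\<^sup>2" using r2 by simp
  then show ?thesis using s0 unfolding s_def by (rule power2_le_imp_le)
qed

text \<open>A kernel vector and its negative both satisfy the dual cone bound, and the cone
  described by that bound contains no line.\<close>

lemma SSC1_left_invertible:
  fixes H :: "real^'r^'n"
  assumes H: "SSC1 H" and r: "CARD('r) \<ge> 2"
  shows "\<exists>L. L ** H = mat 1"
proof -
  have "z = 0" if z: "H *v z = 0" for z
  proof -
    have "norm z \<le> 1 \<bullet> z" "norm (- z) \<le> 1 \<bullet> (- z)"
      using SSC1_dual_cone[OF H r, of z] SSC1_dual_cone[OF H r, of "- z"] z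
      by (simp_all add: vec.neg)
    then have "norm z \<le> 0" unfolding norm_minus_cancel inner_minus_right by linarith
    then show ?thesis by simp
  qed
  then show ?thesis by (simp add: matrix_left_invertible_ker)
qed

text \<open>Along the negative all-ones direction the coordinate sum drops at rate \<open>r\<close>
  but the norm at rate at most \<open>sqrt r\<close>, which is smaller for \<open>r \<ge> 2\<close>.
  Points outside the cone thus lie arbitrarily close to \<open>q\<close>.\<close>

lemma in_frontier_second_order_cone:
  fixes q :: "real^'r"
  assumes "CARD('r) \<ge> 2" and "norm q = 1" and "1 \<bullet> q = 1"
  shows "q \<in> frontier {x. 1 \<bullet> x \<ge> norm x}"
proof -
  define r :: real where "r = real CARD('r)"
  have r2: "r \<ge> 2" using assms by (simp add: r_def)
  have n1: "norm (1 :: real^'r) = sqrt r" by (simp add: norm_one_vec r_def)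
  then have ee: "(1 :: real^'r) \<bullet> 1 = r" using r2 by (simp add: dot_square_norm)
  have "sqrt r < r"
    using r2 by (simp add: real_less_lsqrt power2_eq_square)
  have "\<exists>y. y \<notin> {x. 1 \<bullet> x \<ge> norm x} \<and> dist q y < e" if "e > 0" for e
  proof (intro exI conjI)
    define d where "d = e / (2 * sqrt r)"
    have d: "d > 0" using that r2 by (simp add: d_def)
    let ?y = "q - d *\<^sub>R 1"
    have "1 \<bullet> ?y = 1 - d * r" by (simp add: inner_diff_right ee assms)
    moreover have "norm ?y \<ge> 1 - d * sqrt r"
      using norm_triangle_ineq2[of q "d *\<^sub>R 1"] d assms by (simp add: n1)
    moreover have "d * sqrt r < d * r" using \<open>sqrt r < r\<close> d by simp
    ultimately show "?y \<notin> {x. 1 \<bullet> x \<ge> norm x}" by auto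
    show "dist q ?y < e" using d that r2 by (simp add: dist_norm n1) (simp add: d_def)
  qed
  moreover have "\<exists>y. y \<in> {x. 1 \<bullet> x \<ge> norm x} \<and> dist q y < e" if "e > 0" for e
    using that assms by (intro exI[of _ q]) simp
  ultimately show ?thesis unfolding frontier_straddle by blast
qed

text \<open>This is where SSC2 enters: the frontier point \<open>q\<close> must lie on a coordinate
  ray, and its norm fixes the position on that ray.\<close>

lemma sufficiently_scattered_unit_ray:
  fixes H :: "real^'r^'n"
  assumes H: "sufficiently_scattered H" and "0 \<le> H *v q" and q: "norm q = 1" "1 \<bullet> q = 1"
  shows "\<exists>k. q = axis k 1"
proof -
  have "q \<in> cone_dual (transpose H) \<inter> frontier {x. 1 \<bullet> x \<ge> norm x}"
    using assms in_frontier_second_order_cone[of q]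
    by (simp add: cone_dual_def sufficiently_scattered_def del: transpose_matrix_vector)
  then have "q \<in> {c *\<^sub>R axis k 1 | c k. 0 \<le> c}"
    using H unfolding sufficiently_scattered_def SSC2_def by blast
  then obtain c k where "q = c *\<^sub>R axis k 1" "0 \<le> c" by blast
  with q show ?thesis by (auto simp: norm_axis_1)
qed

text \<open>Nonnegativity of \<open>H ** Q\<close> puts each column of \<open>Q\<close> into the
  dual cone. In the equality case the determinant is nonzero, so the basis vectors found as columns
  are distinct.\<close>

lemma sufficiently_scattered_det_le_1:
  fixes H :: "real^'r^'n" and Q :: "real^'r^'r"
  assumes H: "sufficiently_scattered H" and HQ: "0 \<le> H ** Q" and Q1: "transpose Q *v 1 = 1"
  shows "\<bar>det Q\<bar> \<le> 1" and "1 \<le> \<bar>det Q\<bar> \<Longrightarrow> permutation_matrix Q"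
proof -
  have Hc: "0 \<le> H *v column k Q" for k
  proof -
    have "(H *v column k Q) $ i = (H ** Q) $ i $ k" for i
      by (simp add: matrix_vector_mult_def matrix_matrix_mult_def column_def)
    then show ?thesis using HQ by (simp add: less_eq_vec_def)
  qed
  have c1: "1 \<bullet> column k Q = 1" for k
  proof -
    have "1 \<bullet> column k Q = (transpose Q *v 1) $ k"
      by (simp add: matrix_vector_mult_def transpose_def column_def inner_vec_def
          del: transpose_matrix_vector)
    then show ?thesis using Q1 by simp
  qed
  have nle: "norm (column k Q) \<le> 1" for k
    using SSC1_dual_cone[OF _ _ Hc[of k]] H c1[of k] by (simp add: sufficiently_scattered_def)
  have had: "\<bar>det Q\<bar> \<le> (\<Prod>k\<in>UNIV. norm (column k Q))"
    using Hadamard_inequality[of "transpose Q"] by simp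
  also have "\<dots> \<le> 1" using nle by (intro prod_le_1) auto
  finally show "\<bar>det Q\<bar> \<le> 1" .
  assume ge: "1 \<le> \<bar>det Q\<bar>"
  have "norm (column k Q) = 1" for k
  proof -
    have "1 \<le> norm (column k Q) * (\<Prod>j\<in>UNIV - {k}. norm (column j Q))"
      using had ge by (simp add: prod.remove[of UNIV k])
    also have "\<dots> \<le> norm (column k Q) * 1"
      using nle by (intro mult_left_mono prod_le_1) auto
    finally show ?thesis using nle[of k] by simp
  qed
  then have "\<forall>k. \<exists>i. column k Q = axis i 1"
    using sufficiently_scattered_unit_ray[OF H Hc] c1 by blast
  then obtain p where p: "\<And>k. column k Q = axis (p k) 1" by metis
  have "inj p"
  proof (rule injI, rule ccontr)
    fix j k assume "p j = p k" "j \<noteq> k"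
    then have "det Q = 0" using p by (intro det_identical_columns[of j k]) auto
    then show False using ge by simp
  qed
  then have "p permutes UNIV"
    by (intro bij_imp_permutes) (simp_all add: bij_def finite_UNIV_inj_surj)
  moreover have "Q = (\<chi> i j. if i = p j then 1 else 0)"
  proof -
    have "Q $ i $ j = axis (p j) 1 $ i" for i j
      using p[of j] by (metis column_def vec_lambda_beta)
    then show ?thesis by (simp add: vec_eq_iff axis_def)
  qed
  ultimately show "permutation_matrix Q" unfolding permutation_matrix_def by blast
qed

lemma sufficiently_scattered_left_invertible:
  "sufficiently_scattered H \<Longrightarrow> \<exists>L. L ** H = mat 1"
  unfolding sufficiently_scattered_def by (intro SSC1_left_invertible) auto

section \<open>Identifiability of the factors in steps 2 and 3\<close>

text \<open>\<open>A\<close> and \<open>L ** V\<close> are square of the same size, so a one-sided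
  inverse is two-sided and the relation between \<open>U\<close> and \<open>V\<close> can be
  reversed.\<close>

lemma left_invertible_factor:
  fixes U V :: "real^'r^'n"
  assumes L: "L ** U = mat 1" and U: "U = V ** A"
  shows "V = U ** (L ** V)"
proof -
  have "L ** V ** A = mat 1" using L U by (simp flip: matrix_mul_assoc)
  then have "A ** (L ** V) = mat 1" using matrix_left_right_inverse by blast
  then show ?thesis using U by (metis matrix_mul_assoc matrix_mul_rid)
qed

lemma transpose_mul_one:
  fixes U :: "real^'r^'n" and Q :: "real^'q^'r"
  assumes "transpose U *v 1 = 1" and "transpose (U ** Q) *v 1 = 1"
  shows "transpose Q *v 1 = 1"
proof -
  have "transpose (U ** Q) *v 1 = transpose Q *v (transpose U *v 1)"
    by (simp only: matrix_transpose_mul matrix_vector_mul_assoc)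
  then show ?thesis using assms by simp
qed

text \<open>Cancelling the true factors from \<open>T\<close> gives
  \<open>S = Q1 ** R ** transpose Q2\<close>. Minimality of \<open>\<bar>det R\<bar>\<close> then
  pushes the absolute determinants of \<open>Q1\<close> and \<open>Q2\<close> up to their upper
  bound one.\<close>

lemma step2_identifiable:
  fixes U1 :: "real^'r^'n1" and U2 :: "real^'r^'n2" and S :: "real^'r^'r"
  assumes T: "T = U1 ** S ** transpose U2" and K: "K ** S = mat 1"
    and H1: "sufficiently_scattered U1" "transpose U1 *v 1 = 1"
    and H2: "sufficiently_scattered U2" "transpose U2 *v 1 = 1"
    and opt: "step2_optimal T V1 V2 R"
  shows "\<exists>P1 P2. permutation_matrix P1 \<and> permutation_matrix P2 \<and> V1 = U1 ** P1 \<and> V2 = U2 ** P2"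
proof -
  obtain L1 where L1: "L1 ** U1 = mat 1" using sufficiently_scattered_left_invertible[OF H1(1)] by blast
  obtain L2 where L2: "L2 ** U2 = mat 1" using sufficiently_scattered_left_invertible[OF H2(1)] by blast
  have K': "S ** K = mat 1" using K matrix_left_right_inverse by blast
  have V: "T = V1 ** R ** transpose V2" "transpose V1 *v 1 = 1" "transpose V2 *v 1 = 1" "0 \<le> V1" "0 \<le> V2"
    using opt by (auto simp: step2_optimal_def is_arg_min_def)
  have "0 \<le> U1" "0 \<le> U2" using H1 H2 by (auto simp: sufficiently_scattered_def)
  then have le: "\<bar>det R\<bar> \<le> \<bar>det S\<bar>"
    using opt T H1 H2 by (force simp: step2_optimal_def is_arg_min_def not_less)
  have L1t: "transpose U1 ** transpose L1 = mat 1" and L2t: "transpose U2 ** transpose L2 = mat 1"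
    by (metis L1 matrix_transpose_mul transpose_mat, metis L2 matrix_transpose_mul transpose_mat)
  define Q1 where "Q1 = L1 ** V1"
  define Q2 where "Q2 = L2 ** V2"
  have "U1 = T ** transpose L2 ** K"
    by (simp add: T L2t K' flip: matrix_mul_assoc)
  also have "\<dots> = V1 ** (R ** transpose V2 ** transpose L2 ** K)"
    by (simp add: V(1) matrix_mul_assoc)
  finally have V1: "V1 = U1 ** Q1"
    unfolding Q1_def by (rule left_invertible_factor[OF L1])
  have "transpose S ** transpose K = mat 1" by (metis K matrix_transpose_mul transpose_mat)
  then have "U2 = transpose T ** transpose L1 ** transpose K"
    by (simp add: T L1t matrix_transpose_mul flip: matrix_mul_assoc)
  also have "\<dots> = V2 ** (transpose R ** transpose V1 ** transpose L1 ** transpose K)"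
    by (simp add: V(1) matrix_transpose_mul matrix_mul_assoc)
  finally have V2: "V2 = U2 ** Q2"
    unfolding Q2_def by (rule left_invertible_factor[OF L2])
  have "S = L1 ** T ** transpose L2"
    by (simp add: T matrix_mul_assoc L1) (simp add: L2t flip: matrix_mul_assoc)
  also have "\<dots> = Q1 ** R ** transpose Q2"
    by (simp add: V(1) Q1_def Q2_def matrix_transpose_mul matrix_mul_assoc)
  finally have "det S = det Q1 * det R * det Q2" by (simp add: det_mul)
  then have dS: "\<bar>det S\<bar> = \<bar>det Q1\<bar> * \<bar>det Q2\<bar> * \<bar>det R\<bar>" by (simp add: abs_mult)
  have "det S \<noteq> 0" using K by (metis det_I det_mul mult_zero_right zero_neq_one)
  then have "\<bar>det R\<bar> > 0" using dS by auto
  moreover have "1 * \<bar>det R\<bar> \<le> (\<bar>det Q1\<bar> * \<bar>det Q2\<bar>) * \<bar>det R\<bar>" using le dS by simp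
  ultimately have ge: "1 \<le> \<bar>det Q1\<bar> * \<bar>det Q2\<bar>" by (simp only: mult_le_cancel_right_pos)
  note P1 = sufficiently_scattered_det_le_1[OF H1(1), of Q1, folded V1,
      OF V(4) transpose_mul_one[OF H1(2), of Q1, folded V1, OF V(2)]]
  note P2 = sufficiently_scattered_det_le_1[OF H2(1), of Q2, folded V2,
      OF V(5) transpose_mul_one[OF H2(2), of Q2, folded V2, OF V(3)]]
  have "\<bar>det Q1\<bar> * \<bar>det Q2\<bar> \<le> \<bar>det Q1\<bar>" "\<bar>det Q1\<bar> * \<bar>det Q2\<bar> \<le> \<bar>det Q2\<bar>"
    using P1(1) P2(1) by (simp_all add: mult_left_le mult_left_le_one_le)
  then have d1: "1 \<le> \<bar>det Q1\<bar>" and d2: "1 \<le> \<bar>det Q2\<bar>" using ge by linarith+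
  have "permutation_matrix Q1 \<and> permutation_matrix Q2 \<and> V1 = U1 ** Q1 \<and> V2 = U2 ** Q2"
    by (rule conjI[OF P1(2)[OF d1] conjI[OF P2(2)[OF d2] conjI[OF V1 V2]]])
  then show ?thesis by (intro exI)
qed

text \<open>The determinant cannot vanish along the segment from the identity to the Gram matrix.\<close>

lemma det_gram_pos:
  fixes A :: "real^'n^'m"
  assumes L: "L ** A = mat 1"
  shows "det (transpose A ** A) > 0"
proof (rule ccontr)
  define M where "M t = (1 - t) *\<^sub>R mat 1 + t *\<^sub>R (transpose A ** A)" for t :: real
  assume "\<not> ?thesis"
  then have "det (M 1) \<le> 0" "0 \<le> det (M 0)" by (simp_all add: M_def)
  moreover have "continuous_on {0..1} (\<lambda>t. det (M t))"
    unfolding det_def M_def by (auto intro!: continuous_intros)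
  ultimately obtain t where t: "0 \<le> t" "t \<le> 1" "det (M t) = 0"
    using IVT2'[of "\<lambda>t. det (M t)" 1 0 0] by auto
  have "z = 0" if "M t *v z = 0" for z
  proof -
    have "z \<bullet> ((transpose A ** A) *v z) = (A *v z) \<bullet> (A *v z)"
      by (metis dot_lmul_matrix matrix_vector_mul_assoc transpose_transpose vector_transpose_matrix)
    then have "z \<bullet> (M t *v z) = (1 - t) * (z \<bullet> z) + t * ((A *v z) \<bullet> (A *v z))"
      by (simp add: M_def matrix_vector_mult_add_rdistrib inner_add_right
          flip: scaleR_matrix_vector_assoc)
    then have "(1 - t) * (z \<bullet> z) + t * ((A *v z) \<bullet> (A *v z)) = 0" using that by simp
    then have "(1 - t) * (z \<bullet> z) = 0 \<and> t * ((A *v z) \<bullet> (A *v z)) = 0"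
      using t by (subst (asm) add_nonneg_eq_0_iff) auto
    \<comment> \<open>\<open>t\<close> and \<open>1 - t\<close> cannot both vanish.\<close>
    then have "z = 0 \<or> A *v z = 0" by auto
    then show "z = 0"
      using L by (metis matrix_left_invertible_ker)
  qed
  then have "det (M t) \<noteq> 0"
    by (metis invertible_det_nz invertible_left_inverse matrix_left_invertible_ker)
  then show False using t by simp
qed

text \<open>\<open>S\<close> may be rectangular, so determinants multiply only at the level of Gram
  matrices, where the change of basis contributes \<open>(det Q)\<^sup>2\<close>.\<close>

lemma step3_identifiable:
  fixes U :: "real^'q^'n" and S :: "real^'q^'p"
  assumes T: "T = S ** transpose U" and K: "K ** S = mat 1"
    and H: "sufficiently_scattered U" "transpose U *v 1 = 1"
    and opt: "step3_optimal T V R"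
  shows "\<exists>P. permutation_matrix P \<and> V = U ** P"
proof -
  obtain L where L: "L ** U = mat 1" using sufficiently_scattered_left_invertible[OF H(1)] by blast
  have V: "T = R ** transpose V" "transpose V *v 1 = 1" "0 \<le> V"
    using opt by (auto simp: step3_optimal_def is_arg_min_def)
  have "0 \<le> U" using H by (auto simp: sufficiently_scattered_def)
  then have le: "det (transpose R ** R) \<le> det (transpose S ** S)"
    using opt T H by (force simp: step3_optimal_def is_arg_min_def not_less)
  have Lt: "transpose U ** transpose L = mat 1"
    by (metis L matrix_transpose_mul transpose_mat)
  define Q where "Q = L ** V"
  have "transpose S ** transpose K = mat 1" by (metis K matrix_transpose_mul transpose_mat)
  then have "U = transpose T ** transpose K"
    by (simp add: T matrix_transpose_mul flip: matrix_mul_assoc)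
  also have "\<dots> = V ** (transpose R ** transpose K)"
    by (simp add: V(1) matrix_transpose_mul matrix_mul_assoc)
  finally have VQ: "V = U ** Q"
    unfolding Q_def by (rule left_invertible_factor[OF L])
  have "S = T ** transpose L"
    by (simp add: T Lt flip: matrix_mul_assoc)
  also have "\<dots> = R ** transpose Q"
    by (simp add: V(1) Q_def matrix_transpose_mul matrix_mul_assoc)
  finally have "transpose S ** S = Q ** (transpose R ** R) ** transpose Q"
    by (simp add: matrix_transpose_mul matrix_mul_assoc)
  then have dS: "det (transpose S ** S) = (det Q)\<^sup>2 * det (transpose R ** R)"
    by (simp add: det_mul power2_eq_square)
  \<comment> \<open>Strict positivity carries over to the Gram determinant of \<open>R\<close>,
    which can then be cancelled from the inequality.\<close>
  have "det (transpose S ** S) > 0" by (rule det_gram_pos[OF K])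
  then have "det (transpose R ** R) > 0" unfolding dS by (simp add: zero_less_mult_iff)
  moreover have "1 * det (transpose R ** R) \<le> (det Q)\<^sup>2 * det (transpose R ** R)" using le dS by simp
  ultimately have "1 \<le> (det Q)\<^sup>2" by (simp only: mult_le_cancel_right_pos)
  then have "1 \<le> \<bar>det Q\<bar>" using abs_le_square_iff[of 1 "det Q"] by simp
  then have "permutation_matrix Q"
    by (rule sufficiently_scattered_det_le_1(2)[OF H(1), of Q, folded VQ,
      OF V(3) transpose_mul_one[OF H(2), of Q, folded VQ, OF V(2)]])
  then show ?thesis using VQ by (intro exI conjI)
qed

section \<open>Multilinear algebra of Tucker products and slices\<close>

text \<open>Sums over triples let one \<open>sum.swap\<close> exchange whole blocks of
  indices.\<close>

lemma sum_triple:
  fixes f :: "'a::finite \<Rightarrow> 'b::finite \<Rightarrow> 'c::finite \<Rightarrow> real"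
  shows "(\<Sum>a\<in>UNIV. \<Sum>b\<in>UNIV. \<Sum>c\<in>UNIV. f a b c) = (\<Sum>(a, b, c)\<in>UNIV. f a b c)"
  by (simp add: sum.cartesian_product UNIV_Times_UNIV[symmetric] case_prod_unfold del: UNIV_Times_UNIV)

lemma tucker_nth:
  "tucker U1 U2 U3 G $ j1 $ j2 $ j3 =
    (\<Sum>(i1, i2, i3)\<in>UNIV. U1 $ j1 $ i1 * U2 $ j2 $ i2 * U3 $ j3 $ i3 * G $ i1 $ i2 $ i3)"
  unfolding tucker_def vec_lambda_beta by (rule sum_triple)

text \<open>After exchanging the two blocks of sums, the summand factors over the three modes. Step
  4 thus acts on \<open>G\<close> through products of pseudoinverses with the true factors.\<close>

lemma tucker_tucker:
  "tucker A1 A2 A3 (tucker B1 B2 B3 G) = tucker (A1 ** B1) (A2 ** B2) (A3 ** B3) G"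
proof -
  have "tucker A1 A2 A3 (tucker B1 B2 B3 G) $ i $ j $ k
      = tucker (A1 ** B1) (A2 ** B2) (A3 ** B3) G $ i $ j $ k" for i j k
  proof -
    let ?F = "\<lambda>(a, b, c) (a', b', c'). (A1 $ i $ a * B1 $ a $ a') * (A2 $ j $ b * B2 $ b $ b') *
        (A3 $ k $ c * B3 $ c $ c') * G $ a' $ b' $ c'"
    have "tucker A1 A2 A3 (tucker B1 B2 B3 G) $ i $ j $ k = (\<Sum>x\<in>UNIV. \<Sum>y\<in>UNIV. ?F x y)"
      by (simp add: tucker_nth sum_distrib_left case_prod_unfold mult_ac)
    also have "\<dots> = (\<Sum>y\<in>UNIV. \<Sum>x\<in>UNIV. ?F x y)"
      by (rule sum.swap)
    also have "\<dots> = (\<Sum>(a', b', c')\<in>UNIV. \<Sum>a\<in>UNIV. \<Sum>b\<in>UNIV. \<Sum>c\<in>UNIV. ?F (a, b, c) (a', b', c'))"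
      by (simp add: sum_triple case_prod_unfold)
    also have "\<dots> = (\<Sum>(a', b', c')\<in>UNIV.
        (\<Sum>a\<in>UNIV. A1 $ i $ a * B1 $ a $ a') * (\<Sum>b\<in>UNIV. A2 $ j $ b * B2 $ b $ b') *
        (\<Sum>c\<in>UNIV. A3 $ k $ c * B3 $ c $ c') * G $ a' $ b' $ c')"
      by (simp add: case_prod_unfold flip: sum_distrib_left sum_distrib_right)
    also have "\<dots> = tucker (A1 ** B1) (A2 ** B2) (A3 ** B3) G $ i $ j $ k"
      by (simp add: tucker_nth matrix_matrix_mult_def)
    finally show ?thesis .
  qed
  then show ?thesis by (simp add: vec_eq_iff)
qed

text \<open>Contracting the third mode commutes with multiplying the other two. This gives the input
  of step 2 the form required by \<open>step2_identifiable\<close>.\<close>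

lemma sum_slice3_tucker:
  "(\<Sum>k\<in>UNIV. a $ k *\<^sub>R slice3 (tucker U1 U2 U3 G) k)
    = U1 ** (\<Sum>k\<in>UNIV. (transpose U3 *v a) $ k *\<^sub>R slice3 G k) ** transpose U2"
proof -
  have "(\<Sum>l\<in>UNIV. a $ l * (\<Sum>x\<in>UNIV. \<Sum>y\<in>UNIV. \<Sum>z\<in>UNIV. U1 $ i $ x * U2 $ j $ y * U3 $ l $ z * G $ x $ y $ z))
     = (\<Sum>y\<in>UNIV. (\<Sum>x\<in>UNIV. U1 $ i $ x * (\<Sum>z\<in>UNIV. (\<Sum>l\<in>UNIV. U3 $ l $ z * a $ l) * G $ x $ y $ z)) * U2 $ j $ y)"
     (is "?l = ?r") for i j
  proof -
    let ?f = "\<lambda>l x y z. a $ l * (U1 $ i $ x * U2 $ j $ y * U3 $ l $ z * G $ x $ y $ z)"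
    have "?l = (\<Sum>l\<in>UNIV. \<Sum>(x, y, z)\<in>UNIV. ?f l x y z)"
      by (simp add: sum_triple sum_distrib_left case_prod_unfold)
    also have "\<dots> = (\<Sum>(x, y, z)\<in>UNIV. \<Sum>l\<in>UNIV. ?f l x y z)"
      by (subst sum.swap) (simp add: case_prod_unfold)
    also have "\<dots> = (\<Sum>x\<in>UNIV. \<Sum>y\<in>UNIV. \<Sum>z\<in>UNIV. \<Sum>l\<in>UNIV. ?f l x y z)"
      by (rule sum_triple[symmetric])
    also have "\<dots> = (\<Sum>y\<in>UNIV. \<Sum>x\<in>UNIV. \<Sum>z\<in>UNIV. \<Sum>l\<in>UNIV. ?f l x y z)"
      by (rule sum.swap)
    also have "\<dots> = ?r"
      by (simp add: sum_distrib_left sum_distrib_right mult_ac)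
    finally show ?thesis .
  qed
  then show ?thesis
    by (simp add: vec_eq_iff slice3_def tucker_def matrix_matrix_mult_def matrix_vector_mult_def
        transpose_def del: transpose_matrix_vector)
qed

text \<open>The analogue for the second mode prepares step 3, where a pseudoinverse reduces
  \<open>U1\<close> to a permutation.\<close>

lemma sum_slice2_tucker:
  "(\<Sum>k\<in>UNIV. b $ k *\<^sub>R slice2 (tucker U1 U2 U3 G) k)
    = U1 ** (\<Sum>k\<in>UNIV. (transpose U2 *v b) $ k *\<^sub>R slice2 G k) ** transpose U3"
proof -
  have "(\<Sum>l\<in>UNIV. b $ l * (\<Sum>x\<in>UNIV. \<Sum>y\<in>UNIV. \<Sum>z\<in>UNIV. U1 $ i $ x * U2 $ l $ y * U3 $ j $ z * G $ x $ y $ z))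
     = (\<Sum>z\<in>UNIV. (\<Sum>x\<in>UNIV. U1 $ i $ x * (\<Sum>y\<in>UNIV. (\<Sum>l\<in>UNIV. U2 $ l $ y * b $ l) * G $ x $ y $ z)) * U3 $ j $ z)"
     (is "?l = ?r") for i j
  proof -
    let ?f = "\<lambda>l x y z. b $ l * (U1 $ i $ x * U2 $ l $ y * U3 $ j $ z * G $ x $ y $ z)"
    have "?l = (\<Sum>l\<in>UNIV. \<Sum>(x, y, z)\<in>UNIV. ?f l x y z)"
      by (simp add: sum_triple sum_distrib_left case_prod_unfold)
    also have "\<dots> = (\<Sum>(x, y, z)\<in>UNIV. \<Sum>l\<in>UNIV. ?f l x y z)"
      by (subst sum.swap) (simp add: case_prod_unfold)
    also have "\<dots> = (\<Sum>x\<in>UNIV. \<Sum>y\<in>UNIV. \<Sum>z\<in>UNIV. \<Sum>l\<in>UNIV. ?f l x y z)"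
      by (rule sum_triple[symmetric])
    also have "\<dots> = (\<Sum>x\<in>UNIV. \<Sum>z\<in>UNIV. \<Sum>y\<in>UNIV. \<Sum>l\<in>UNIV. ?f l x y z)"
      by (intro sum.cong refl sum.swap)
    also have "\<dots> = (\<Sum>z\<in>UNIV. \<Sum>x\<in>UNIV. \<Sum>y\<in>UNIV. \<Sum>l\<in>UNIV. ?f l x y z)"
      by (rule sum.swap)
    also have "\<dots> = ?r"
      by (simp add: sum_distrib_left sum_distrib_right mult_ac)
    finally show ?thesis .
  qed
  then show ?thesis
    by (simp add: vec_eq_iff slice2_def tucker_def matrix_matrix_mult_def matrix_vector_mult_def
        transpose_def del: transpose_matrix_vector)
qed

section \<open>Almost sure recovery of the decomposition\<close>

text \<open>A left inverse of \<open>U\<close> makes \<open>transpose U\<close> surjective, so the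
  coefficients \<open>v\<close> of the full rank combination arise from the parameter
  \<open>transpose L *v v\<close>. One such parameter is enough.\<close>

lemma AE_slice_combination_left_invertible:
  fixes U :: "real^'r^'n" and A :: "'r \<Rightarrow> real^'q^'p"
  assumes L: "L ** U = mat 1"
    and ex: "\<exists>B \<in> {\<Sum>k\<in>UNIV. v $ k *\<^sub>R A k | v :: real^'r. 0 \<le> v}. rank B = CARD('q)"
  shows "AE a in lborel. \<exists>K. K ** (\<Sum>k\<in>UNIV. (transpose U *v a) $ k *\<^sub>R A k) = mat 1"
proof -
  obtain v :: "real^'r" where "rank (\<Sum>k\<in>UNIV. v $ k *\<^sub>R A k) = CARD('q)"
    using ex by blast
  then obtain K where K: "K ** (\<Sum>k\<in>UNIV. v $ k *\<^sub>R A k) = mat 1"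
    using full_rank_injective matrix_left_invertible_injective by blast
  have "transpose U ** transpose L = mat 1"
    by (metis L matrix_transpose_mul transpose_mat)
  then have "transpose U *v (transpose L *v v) = v"
    by (metis matrix_vector_mul_assoc matrix_vector_mul_lid)
  moreover have "linear (\<lambda>a. \<Sum>k\<in>UNIV. (transpose U *v a) $ k *\<^sub>R A k)"
    by (intro linearI)
      (simp_all add: matrix_vector_right_distrib matrix_vector_mult_scaleR scaleR_add_left
        sum.distrib scaleR_sum_right del: transpose_matrix_vector)
  ultimately show ?thesis
    using AE_left_invertible[of _ K "transpose L *v v"] K by presburger
qed

lemma permutation_matrix_orthogonal:
  assumes "permutation_matrix P"
  shows "P ** transpose P = mat 1" "transpose P ** P = mat 1"
proof -
  obtain p where p: "p permutes UNIV" and P: "P = (\<chi> i j. if i = p j then 1 else 0)"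
    using assms unfolding permutation_matrix_def by blast
  have "inj p" using p by (rule permutes_inj)
  then have "(\<Sum>k\<in>UNIV. (if k = p i then 1 else 0) * (if k = p j then 1 else 0 :: real)) = (if i = j then 1 else 0)" for i j
    by (simp add: if_distrib[of "\<lambda>x. x * _"] inj_eq cong: if_cong)
  then show "transpose P ** P = mat 1"
    by (simp add: P transpose_def matrix_matrix_mult_def mat_def vec_eq_iff)
  then show "P ** transpose P = mat 1"
    using matrix_left_right_inverse by blast
qed

text \<open>The pseudoinverse is a left inverse of \<open>U ** P\<close>, and
  \<open>transpose P\<close> undoes \<open>P\<close>. This is how computed factors cancel against
  true ones in steps 3 and 4.\<close>

lemma pinv_mult_permutation:
  fixes U :: "real^'r^'n"
  assumes L: "L ** U = mat 1" and P: "permutation_matrix P"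
  shows "pinv (U ** P) ** U = transpose P"
proof -
  have "transpose P ** L ** (U ** P) = mat 1"
    using permutation_matrix_orthogonal(2)[OF P]
    by (metis L matrix_mul_assoc matrix_mul_rid)
  then have "pinv (U ** P) ** (U ** P) = mat 1" by (rule pinv_left_inverse)
  then have "pinv (U ** P) ** U ** (P ** transpose P) = transpose P"
    by (simp add: matrix_mul_assoc)
  then show ?thesis by (simp add: permutation_matrix_orthogonal[OF P])
qed

theorem theorem5p14:
  fixes T :: "('n1::finite, 'n2::finite, 'n3::finite) tensor"
    and U1 :: "real^'r^'n1" and U2 :: "real^'r^'n2" and U3 :: "real^'r3^'n3"
    and G :: "('r::finite, 'r, 'r3::finite) tensor"
    and M :: "'w measure" and \<alpha> :: "'w \<Rightarrow> real^'n3" and \<beta> :: "'w \<Rightarrow> real^'n2"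
  assumes "T = tucker U1 U2 U3 G"
    and "0 \<le> U1" and "0 \<le> U2" and "0 \<le> U3"
    and "transpose U1 *v 1 = 1" and "transpose U2 *v 1 = 1" and "transpose U3 *v 1 = 1"
    and "CARD('r3) \<le> CARD('r)"
    and "sufficiently_scattered U1" and "sufficiently_scattered U2"
    and "sufficiently_scattered U3"
    and "\<exists>A \<in> {\<Sum>k\<in>UNIV. v $ k *\<^sub>R slice3 G k | v :: real^'r3. 0 \<le> v}. rank A = CARD('r)"
    and "\<exists>A \<in> {\<Sum>k\<in>UNIV. v $ k *\<^sub>R slice2 G k | v :: real^'r. 0 \<le> v}. rank A = CARD('r3)"
    and "prob_space M"
    and "continuous_random_vector M \<alpha>" and "continuous_random_vector M \<beta>"
  shows "AE \<omega> in M. \<forall>U1' U2' U3' G'.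
    procedure_output T (\<alpha> \<omega>) (\<beta> \<omega>) U1' U2' U3' G' \<longrightarrow>
    (\<exists>(P1 :: real^'r^'r) (P2 :: real^'r^'r) (P3 :: real^'r3^'r3).
      permutation_matrix P1 \<and> permutation_matrix P2 \<and> permutation_matrix P3 \<and>
      U1' = U1 ** P1 \<and> U2' = U2 ** P2 \<and> U3' = U3 ** P3 \<and>
      G' = tucker (transpose P1) (transpose P2) (transpose P3) G)"
proof -
  note ss1 = assms(9) and ss2 = assms(10) and ss3 = assms(11)
  obtain L1 where L1: "L1 ** U1 = mat 1" using sufficiently_scattered_left_invertible[OF ss1] by blast
  obtain L2 where L2: "L2 ** U2 = mat 1" using sufficiently_scattered_left_invertible[OF ss2] by blast
  obtain L3 where L3: "L3 ** U3 = mat 1" using sufficiently_scattered_left_invertible[OF ss3] by blast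
  let ?Sa = "\<lambda>a. \<Sum>k\<in>UNIV. (transpose U3 *v a) $ k *\<^sub>R slice3 G k"
  let ?Sb = "\<lambda>b. \<Sum>k\<in>UNIV. (transpose U2 *v b) $ k *\<^sub>R slice2 G k"
  have "AE \<omega> in M. \<exists>K. K ** ?Sa (\<alpha> \<omega>) = mat 1"
    by (rule AE_continuous_random_vector[OF assms(15) AE_slice_combination_left_invertible[OF L3 assms(12)]])
  moreover have "AE \<omega> in M. \<exists>K. K ** ?Sb (\<beta> \<omega>) = mat 1"
    by (rule AE_continuous_random_vector[OF assms(16) AE_slice_combination_left_invertible[OF L2 assms(13)]])
  \<comment> \<open>Both events hold together almost surely, whatever the joint law of
    \<open>\<alpha>\<close> and \<open>\<beta>\<close>; the rest is deterministic.\<close>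
  ultimately show ?thesis
  proof eventually_elim
    case (elim \<omega>)
    then obtain Ka Kb where Ka: "Ka ** ?Sa (\<alpha> \<omega>) = mat 1" and Kb: "Kb ** ?Sb (\<beta> \<omega>) = mat 1"
      by blast
    show ?case
    proof (intro allI impI)
      fix V1 :: "real^'r^'n1" and V2 :: "real^'r^'n2" and V3 :: "real^'r3^'n3" and G'
      assume "procedure_output T (\<alpha> \<omega>) (\<beta> \<omega>) V1 V2 V3 G'"
      then obtain Ra Rb where
        o2: "step2_optimal (U1 ** ?Sa (\<alpha> \<omega>) ** transpose U2) V1 V2 Ra" and
        o3: "step3_optimal (pinv V1 ** (U1 ** ?Sb (\<beta> \<omega>) ** transpose U3)) V3 Rb" and
        G': "G' = tucker (pinv V1 ** U1) (pinv V2 ** U2) (pinv V3 ** U3) G"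
        unfolding procedure_output_def assms(1) sum_slice3_tucker sum_slice2_tucker tucker_tucker
        by blast
      obtain P1 P2 where P: "permutation_matrix P1" "permutation_matrix P2"
        and V: "V1 = U1 ** P1" "V2 = U2 ** P2"
        using step2_identifiable[OF refl Ka ss1 assms(5) ss2 assms(6) o2] by blast
      \<comment> \<open>The input of step 3 still has the true \<open>U3\<close> as a factor; step 2
        only permutes the rows of the core, which keeps full column rank.\<close>
      have T\<beta>: "pinv V1 ** (U1 ** ?Sb (\<beta> \<omega>) ** transpose U3)
          = (transpose P1 ** ?Sb (\<beta> \<omega>)) ** transpose U3"
        unfolding V by (simp only: matrix_mul_assoc pinv_mult_permutation[OF L1 P(1)])
      have "(Kb ** P1) ** (transpose P1 ** ?Sb (\<beta> \<omega>)) = Kb ** (P1 ** transpose P1) ** ?Sb (\<beta> \<omega>)"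
        by (simp only: matrix_mul_assoc)
      also have "\<dots> = mat 1"
        by (simp only: permutation_matrix_orthogonal(1)[OF P(1)] matrix_mul_rid Kb)
      finally obtain P3 where P3: "permutation_matrix P3" "V3 = U3 ** P3"
        using step3_identifiable[OF T\<beta> _ ss3 assms(7) o3] by metis
      show "\<exists>P1 P2 P3. permutation_matrix P1 \<and> permutation_matrix P2 \<and> permutation_matrix P3 \<and>
          V1 = U1 ** P1 \<and> V2 = U2 ** P2 \<and> V3 = U3 ** P3 \<and>
          G' = tucker (transpose P1) (transpose P2) (transpose P3) G"
        unfolding G' V P3(2) pinv_mult_permutation[OF L1 P(1)] pinv_mult_permutation[OF L2 P(2)]
          pinv_mult_permutation[OF L3 P3(1)]
        by (rule exI[of _ P1], rule exI[of _ P2], rule exI[of _ P3])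
          (simp add: P P3(1))
    qed
  qed
qed

end
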